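(* Let $p$ be an odd prime and $m$ a positive integer. Then: (i) $\det A_{p,m}\equiv 0\pmod 4$ for $p\ge 5$. (ii) $\det A_{3,m}=1-4^m$. Hence $A_{3,m}$ is invertible for every $m\ge 1$. (iii) $\det A_{p,m}\equiv 0\pmod p$ for every odd prime $p$ and every $m\ge 1$. (iv) $\det A_{p,1}=0$ for every prime $p\ge 5$. Hence $A_{p,1}$ is not invertible for such $p$. (v) $\det A_{p,m}\neq 0$ if $(p-1)^m-\sum_{k=1}^{p-2}k^m>0$. Thus, for any fixed odd prime $p$, $\det A_{p,m}$ is nonzero for all sufficiently large $m$. In particular, $\det A_{p,m}$ is nonzero if $m\ge \log(p-2)\big/\log\left(\frac{p-1}{p-2}\right)$.
   Context: For an integer $a$ and an integer $p>1$, $a\,(\mathbb{Z}_p)$ denotes the remainder $r\in\{0,1,\dots,p-1\}$ of $a$ on division by $p$, regarded as an integer. For an odd prime $p$ and $1\le i\le p-1$, $i^{-1}$ denotes the multiplicative inverse of $i$ modulo $p$. For an odd prime $p$ and a positive integer $m$, $A_{p,m}$ is the $(p-1)\times(p-1)$ integer matrix $A_{p,m}=\left[(i^{-1}\cdot j\,(\mathbb{Z}_p))^m\right]_{i,j=1}^{p-1}$, where the outer exponentiation is taken in the integers. Invertibility is over the complex (equivalently rational) numbers. *)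

theory Defs
  imports
    Complex_Main
    "HOL-Number_Theory.Modular_Inverse"
    "Jordan_Normal_Form.Determinant"
begin

text \<open>
  Matrices are indexed from \<open>0\<close>, so the entry at position \<open>(i, j)\<close> is the one that is numbered
  \<open>(i + 1, j + 1)\<close> when rows and columns run over \<open>1, \<dots>, p - 1\<close>. The reduction modulo \<open>p\<close> takes place
  before the power is formed.
\<close>

definition A :: "nat \<Rightarrow> nat \<Rightarrow> int mat" where
  "A p m = mat (p - 1) (p - 1)
     (\<lambda>(i, j). ((modular_inverse (int p) (int (i + 1)) * int (j + 1)) mod int p) ^ m)"

text \<open>
  An integer matrix counts as invertible if it is so over the complex numbers; the predicate
  \<open>invertible_mat\<close> on \<open>int mat\<close> would ask for an inverse with integer entries.
\<close>

definition complex_invertible :: "int mat \<Rightarrow> bool" where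
  "complex_invertible M \<longleftrightarrow> invertible_mat (map_mat complex_of_int M)"

end

theory Submission
  imports Defs
begin

text \<open>
  Write \<open>e i j\<close> for the residue \<open>i\<^sup>-\<^sup>1 j\<close> modulo \<open>p\<close>. Then \<open>e (p - i) j = e i (p - j) = p - e i j\<close>, so the sum
  of two opposite rows has entries \<open>a\<^sup>m + (p - a)\<^sup>m\<close>. These are all odd, and equal to \<open>p\<close> if \<open>m = 1\<close>.
  For \<open>p \<ge> 5\<close> there are two different pairs of opposite rows. Subtracting the two sums gives a row of
  even entries, which vanishes if \<open>m = 1\<close>; doing the same to the columns yields the second factor 2.
  Modulo \<open>p\<close> the matrix has rank 1. Finally, every column contains an entry \<open>(p - 1)\<^sup>m\<close>, and the
  remaining entries of the row of that entry are \<open>1\<^sup>m, \<dots>, (p - 2)\<^sup>m\<close>, so that \<open>A p m\<close> is strictly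
  diagonally dominant, up to a permutation of its rows, once \<open>(p - 1)\<^sup>m\<close> exceeds their sum.
\<close>

section \<open>Determinants\<close>

lemma dvd_det_if_dvd_row:
  fixes M :: "'a :: comm_ring_1 mat"
  assumes "M \<in> carrier_mat n n" "k < n" "\<And>j. j < n \<Longrightarrow> d dvd M $$ (k, j)"
  shows "d dvd det M"
  unfolding laplace_expansion_row[OF assms(1,2)] by (intro dvd_sum dvd_mult2 assms) simp

text \<open>In the Leibniz formula a permutation either picks the entry \<open>(k, l)\<close>, which
  has both factors by itself, or picks two different entries, one in row \<open>k\<close> giving
  \<open>d\<close> and one in column \<open>l\<close> giving \<open>e\<close>.\<close>

lemma mult_dvd_det_if_dvd_row_col:
  fixes M :: "'a :: comm_ring_1 mat"
  assumes M: "M \<in> carrier_mat n n" and "k < n" "l < n"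
    and row: "\<And>j. j < n \<Longrightarrow> d dvd M $$ (k, j)"
    and col: "\<And>i. i < n \<Longrightarrow> e dvd M $$ (i, l)"
    and kl: "d * e dvd M $$ (k, l)"
  shows "d * e dvd det M"
  unfolding det_def'[OF M]
proof (intro dvd_sum dvd_mult)
  fix \<pi> assume "\<pi> \<in> {\<pi>. \<pi> permutes {0..<n}}"
  then have \<pi>: "\<pi> permutes {0..<n}" by simp
  let ?f = "\<lambda>i. M $$ (i, \<pi> i)"
  show "d * e dvd (\<Prod>i = 0..<n. ?f i)"
  proof (cases "\<pi> k = l")
    case True
    with kl have "d * e dvd ?f k"
      by simp
    also have "?f k dvd (\<Prod>i = 0..<n. ?f i)"
      using \<open>k < n\<close> by (intro dvd_prodI) auto
    finally show ?thesis .
  next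
    case False
    have "l \<in> \<pi> ` {0..<n}"
      using \<open>l < n\<close> by (simp add: permutes_image[OF \<pi>])
    then obtain i where i: "i < n" "\<pi> i = l"
      by auto
    with False have "i \<noteq> k" by auto
    have "\<pi> k < n"
      using permutes_in_image[OF \<pi>, of k] \<open>k < n\<close> by simp
    then have "d * e dvd ?f k * ?f i"
      using i by (intro mult_dvd_mono row) (auto simp: col)
    also have "?f k * ?f i = prod ?f {k, i}"
      using \<open>i \<noteq> k\<close> by simp
    also have "\<dots> dvd (\<Prod>i = 0..<n. ?f i)"
      using i \<open>k < n\<close> by (intro prod_dvd_prod_subset) auto
    finally show ?thesis .
  qed
qed

text \<open>Levy-Desplanques up to a permutation of rows: a kernel vector is tested at a coordinate
  \<open>j\<close> of maximal absolute value, in the row dominated by its entry in column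
  \<open>j\<close>.\<close>

lemma det_nonzero_if_dominant:
  fixes M :: "'a :: linordered_idom mat"
  assumes M: "M \<in> carrier_mat n n"
    and dom: "\<And>j. j < n \<Longrightarrow> \<exists>i<n. (\<Sum>k\<in>{0..<n} - {j}. \<bar>M $$ (i, k)\<bar>) < \<bar>M $$ (i, j)\<bar>"
  shows "det M \<noteq> 0"
proof
  assume "det M = 0"
  then obtain v where v: "v \<in> carrier_vec n" "v \<noteq> 0\<^sub>v n" "M *\<^sub>v v = 0\<^sub>v n"
    using det_0_iff_vec_prod_zero[OF M] by blast
  obtain l where l: "l < n" "v $ l \<noteq> 0"
    using v(1,2) by (metis carrier_vecD eq_vecI index_zero_vec)
  define S where "S = (\<lambda>j. \<bar>v $ j\<bar>) ` {0..<n}"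
  have "finite S" "S \<noteq> {}"
    using l by (auto simp: S_def)
  then have "Max S \<in> S" by simp
  then obtain j where j: "j < n" "Max S = \<bar>v $ j\<bar>"
    by (auto simp: S_def)
  have max: "\<bar>v $ k\<bar> \<le> \<bar>v $ j\<bar>" if "k < n" for k
    unfolding j(2)[symmetric] using that \<open>finite S\<close> by (intro Max_ge) (auto simp: S_def)
  have pos: "\<bar>v $ j\<bar> > 0"
    using max[of l] l by (metis order_less_le_trans zero_less_abs_iff)
  obtain i where i: "i < n" "(\<Sum>k\<in>{0..<n} - {j}. \<bar>M $$ (i, k)\<bar>) < \<bar>M $$ (i, j)\<bar>"
    using dom j(1) by blast
  have "(\<Sum>k = 0..<n. M $$ (i, k) * v $ k) = (M *\<^sub>v v) $ i"
    using M v(1) i(1) by (simp add: scalar_prod_def)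
  then have "M $$ (i, j) * v $ j + (\<Sum>k\<in>{0..<n} - {j}. M $$ (i, k) * v $ k) = 0"
    using v(3) i(1) j(1) by (simp add: sum.remove[of _ j])
  then have "\<bar>M $$ (i, j)\<bar> * \<bar>v $ j\<bar> = \<bar>\<Sum>k\<in>{0..<n} - {j}. M $$ (i, k) * v $ k\<bar>"
    by (metis abs_minus_cancel abs_mult eq_neg_iff_add_eq_0)
  also have "\<dots> \<le> (\<Sum>k\<in>{0..<n} - {j}. \<bar>M $$ (i, k)\<bar> * \<bar>v $ k\<bar>)"
    by (rule order_trans[OF sum_abs]) (simp add: abs_mult)
  also have "\<dots> \<le> (\<Sum>k\<in>{0..<n} - {j}. \<bar>M $$ (i, k)\<bar>) * \<bar>v $ j\<bar>"
    unfolding sum_distrib_right by (intro sum_mono mult_left_mono max) auto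
  also have "\<dots> < \<bar>M $$ (i, j)\<bar> * \<bar>v $ j\<bar>"
    using i(2) pos by (rule mult_strict_right_mono)
  finally show False by simp
qed

lemma det_2x2:
  fixes M :: "'a :: comm_ring_1 mat"
  assumes "M \<in> carrier_mat 2 2"
  shows "det M = M $$ (0, 0) * M $$ (1, 1) - M $$ (0, 1) * M $$ (1, 0)"
proof -
  have "det (mat_delete M 0 j) = M $$ (1, 1 - j)" if "j < 2" for j
    using assms that by (subst det_single) (auto simp: mat_delete_def less_2_cases_iff)
  then show ?thesis
    using laplace_expansion_row[OF assms, of 0]
    by (simp add: cofactor_def numeral_2_eq_2)
qed

lemma complex_invertible_iff_det_nonzero:
  assumes M: "M \<in> carrier_mat n n"
  shows "complex_invertible M \<longleftrightarrow> det M \<noteq> 0"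
proof -
  let ?C = "map_mat complex_of_int M"
  have C: "?C \<in> carrier_mat n n"
    using M by simp
  have det: "det ?C = of_int (det M)"
    by (rule of_int_hom.hom_det)
  show ?thesis
  proof
    assume "complex_invertible M"
    then obtain B where B: "?C * B = 1\<^sub>m n" "B * ?C = 1\<^sub>m (dim_row B)"
      using M unfolding complex_invertible_def invertible_mat_def inverts_mat_def by auto
    \<comment> \<open>Comparing the numbers of columns in both equations fixes both dimensions of
      \<open>B\<close>.\<close>
    then have "B \<in> carrier_mat n n"
      using C by (metis carrier_matD(2) carrier_matI index_mult_mat(3) index_one_mat(3))
    then have "det ?C * det B = 1"
      using det_mult[OF C] B(1) by (metis det_one)
    then show "det M \<noteq> 0"
      unfolding det by auto
  next
    assume "det M \<noteq> 0"
    then have "?C \<in> Units (ring_mat TYPE(complex) n ())"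
      by (intro det_non_zero_imp_unit[OF C]) (simp only: det of_int_eq_0_iff not_False_eq_True)
    then obtain B where "B \<in> carrier_mat n n" "?C * B = 1\<^sub>m n" "B * ?C = 1\<^sub>m n"
      unfolding Units_def ring_mat_def by auto
    then show "complex_invertible M"
      using C unfolding complex_invertible_def invertible_mat_def inverts_mat_def by auto
  qed
qed

section \<open>Quotients modulo a prime\<close>

text \<open>The residue \<open>e i j\<close> from above. Its arguments are numbered from 1, so the
  opposite of \<open>i\<close> is \<open>p - i\<close>.\<close>

definition mod_quot :: "nat \<Rightarrow> nat \<Rightarrow> nat \<Rightarrow> int" where
  "mod_quot p i j = (modular_inverse (int p) (int i) * int j) mod int p"

lemma A_carrier: "A p m \<in> carrier_mat (p - 1) (p - 1)"
  by (simp add: A_def)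

lemma A_index:
  assumes "i < p - 1" "j < p - 1"
  shows "A p m $$ (i, j) = mod_quot p (Suc i) (Suc j) ^ m"
  using assms by (simp add: A_def mod_quot_def)

lemma coprime_prime_if_less:
  fixes p i :: nat
  assumes "prime p" "0 < i" "i < p"
  shows "coprime (int i) (int p)"
proof -
  have "\<not> p dvd i"
    using assms by (auto dest: dvd_imp_le)
  then show ?thesis
    using prime_imp_coprime[OF assms(1)] by (simp add: coprime_commute)
qed

lemma mod_quot_eqI:
  assumes "coprime (int i) (int p)" "0 \<le> e" "e < int p" "[int i * e = int j] (mod int p)"
  shows "mod_quot p i j = e"
proof -
  let ?r = "modular_inverse (int p) (int i)"
  have "[?r * int j = ?r * (int i * e)] (mod int p)"
    using assms(4) by (intro cong_mult cong_refl) (rule cong_sym)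
  also have "?r * (int i * e) = ?r * int i * e"
    by simp
  also have "[\<dots> = 1 * e] (mod int p)"
    using assms(1) by (intro cong_mult cong_refl cong_modular_inverse2)
  finally show ?thesis
    using assms(2,3) by (simp add: mod_quot_def cong_def)
qed

lemma mod_quot_cong:
  assumes "coprime (int i) (int p)"
  shows "[int i * mod_quot p i j = int j] (mod int p)"
proof -
  let ?r = "modular_inverse (int p) (int i)"
  have "[int i * mod_quot p i j = int i * ?r * int j] (mod int p)"
    by (simp add: mod_quot_def cong_def mod_mult_right_eq mult.assoc)
  also have "[int i * ?r * int j = 1 * int j] (mod int p)"
    using assms by (intro cong_mult cong_refl cong_modular_inverse1)
  finally show ?thesis by simp
qed

lemma mod_quot_self:
  assumes "prime p" "0 < i" "i < p"
  shows "mod_quot p i i = 1"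
  using assms by (intro mod_quot_eqI coprime_prime_if_less) (auto simp: prime_gt_1_nat)

text \<open>Multiplication by a unit permutes the nonzero residues, so each row takes every value
  from \<open>1\<close> to \<open>p - 1\<close> once.\<close>

lemma mod_quot_bij_betw:
  assumes "prime p" "0 < i" "i < p"
  shows "bij_betw (mod_quot p i) {1..<p} {1..<int p}"
proof -
  have "coprime (modular_inverse (int p) (int i)) (int p)"
    using coprime_prime_if_less[OF assms] by simp
  then have "bij_betw (\<lambda>j. modular_inverse (int p) (int i) * j mod int p) {1..<int p} {1..<int p}"
    by (rule bij_betw_int_remainders_mult)
  moreover have "bij_betw int {1..<p} {1..<int p}"
    by (metis bij_betw_def image_int_atLeastLessThan inj_on_of_nat of_nat_1)
  ultimately have "bij_betw ((\<lambda>j. modular_inverse (int p) (int i) * j mod int p) \<circ> int) {1..<p} {1..<int p}"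
    by (rule bij_betw_trans[rotated])
  then show ?thesis
    by (simp add: mod_quot_def[abs_def] comp_def)
qed

lemma mod_quot_bounds:
  assumes "prime p" "0 < i" "i < p" "0 < j" "j < p"
  shows "1 \<le> mod_quot p i j" "mod_quot p i j < int p"
  using bij_betwE[OF mod_quot_bij_betw[OF assms(1-3)]] assms(4,5) by auto

lemma mod_quot_opposite_col:
  assumes "prime p" "0 < i" "i < p" "0 < j" "j < p"
  shows "mod_quot p i (p - j) = int p - mod_quot p i j"
proof (rule mod_quot_eqI)
  show "coprime (int i) (int p)"
    using assms by (intro coprime_prime_if_less)
  from mod_quot_cong[OF this, of j]
  have "[int i * int p - int i * mod_quot p i j = int p - int j] (mod int p)"
    by (intro cong_diff) (auto simp: cong_def)
  then show "[int i * (int p - mod_quot p i j) = int (p - j)] (mod int p)"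
    using assms by (simp add: right_diff_distrib of_nat_diff)
qed (use mod_quot_bounds[OF assms] in auto)

lemma mod_quot_opposite_row:
  assumes "prime p" "0 < i" "i < p" "0 < j" "j < p"
  shows "mod_quot p (p - i) j = int p - mod_quot p i j"
proof (rule mod_quot_eqI)
  show "coprime (int (p - i)) (int p)"
    using assms by (intro coprime_prime_if_less) auto
  \<comment> \<open>Modulo \<open>p\<close> both factors are negated, and the two signs
    cancel.\<close>
  have "[(int p - int i) * (int p - mod_quot p i j) = (0 - int i) * (0 - mod_quot p i j)] (mod int p)"
    by (intro cong_mult cong_diff) (auto simp: cong_def)
  also have "(0 - int i) * (0 - mod_quot p i j) = int i * mod_quot p i j"
    by simp
  also have "[\<dots> = int j] (mod int p)"
    using assms by (intro mod_quot_cong coprime_prime_if_less)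
  finally show "[int (p - i) * (int p - mod_quot p i j) = int j] (mod int p)"
    using assms by (simp add: of_nat_diff)
qed (use mod_quot_bounds[OF assms] in auto)

section \<open>The matrix \<open>A p m\<close>\<close>

lemma det_A_3: "det (A 3 m) = 1 - 4 ^ m"
proof -
  have "mod_quot 3 1 1 = 1" "mod_quot 3 1 2 = 2" "mod_quot 3 2 1 = 2" "mod_quot 3 2 2 = 1"
    by (auto intro!: mod_quot_eqI coprime_prime_if_less simp: cong_def)
  then have "A 3 m $$ (0, 0) = 1" "A 3 m $$ (0, 1) = 2 ^ m"
    "A 3 m $$ (1, 0) = 2 ^ m" "A 3 m $$ (1, 1) = 1"
    by (simp_all add: A_index numeral_2_eq_2)
  then show ?thesis
    using det_2x2[of "A 3 m"] A_carrier[of 3 m] by (simp flip: power_mult_distrib)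
qed

lemma det_A_cong_0_mod_prime:
  assumes "prime p" "odd p"
  shows "[det (A p m) = 0] (mod int p)"
proof -
  have "p > 2"
    using assms by (metis dvd_refl le_neq_implies_less prime_ge_2_nat)
  \<comment> \<open>Modulo \<open>p\<close>, the row of index 1 is \<open>c\<close> times the row of
    index 0, whose entries are the powers \<open>Suc j ^ m\<close>.\<close>
  define c where "c = modular_inverse (int p) 2 ^ m"
  define B where "B = addrow (- c) 1 0 (A p m)"
  have B: "B \<in> carrier_mat (p - 1) (p - 1)"
    using A_carrier[of p m] by (simp add: B_def)
  have "det B = det (A p m)"
    unfolding B_def using \<open>p > 2\<close> by (intro det_addrow[OF _ _ A_carrier]) auto
  moreover have "int p dvd det B"
  proof (rule dvd_det_if_dvd_row[OF B])
    fix j assume j: "j < p - 1"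
    have "mod_quot p 1 (Suc j) = int (Suc j)"
      using j by (intro mod_quot_eqI) auto
    then have "B $$ (1, j) = mod_quot p 2 (Suc j) ^ m - (modular_inverse (int p) 2 * int (Suc j)) ^ m"
      using j \<open>p > 2\<close> A_carrier[of p m]
      by (simp add: B_def c_def A_index power_mult_distrib numeral_2_eq_2 del: of_nat_Suc)
    moreover have "[mod_quot p 2 (Suc j) ^ m = (modular_inverse (int p) 2 * int (Suc j)) ^ m] (mod int p)"
      by (intro cong_pow) (simp add: mod_quot_def cong_def)
    ultimately show "int p dvd B $$ (1, j)"
      by (simp add: cong_iff_dvd_diff)
  qed (use \<open>p > 2\<close> in auto)
  ultimately show ?thesis
    by (simp add: cong_0_iff)
qed

section \<open>Folding opposite rows and columns\<close>

text \<open>Subtracts the sums of the two outermost opposite pairs of rows, storing the result in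
  row 0. Row additions are used so that the determinant is visibly preserved.\<close>

definition fold_rows :: "int mat \<Rightarrow> int mat" where
  "fold_rows M = addrow (- 1) 0 (dim_row M - 2) (addrow (- 1) 0 1 (addrow 1 0 (dim_row M - 1) M))"

lemma fold_rows:
  assumes "M \<in> carrier_mat n n" "n \<ge> 4"
  shows "fold_rows M \<in> carrier_mat n n" "det (fold_rows M) = det M"
    "\<And>j. j < n \<Longrightarrow> fold_rows M $$ (0, j) =
       M $$ (0, j) + M $$ (n - 1, j) - (M $$ (1, j) + M $$ (n - 2, j))"
    "\<And>i j. 0 < i \<Longrightarrow> i < n \<Longrightarrow> j < n \<Longrightarrow> fold_rows M $$ (i, j) = M $$ (i, j)"
  using assms by (auto simp: fold_rows_def det_addrow[of _ n])

lemma det_A_1_eq_0: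
  assumes "prime p" "p \<ge> 5"
  shows "det (A p 1) = 0"
proof -
  have n: "p - 1 \<ge> 4"
    using assms(2) by simp
  note F = fold_rows[OF A_carrier[of p 1] n]
  \<comment> \<open>Divisibility by \<open>0\<close> means being zero. Both pair sums equal
    \<open>p\<close>, so the folded row vanishes.\<close>
  have "0 dvd det (fold_rows (A p 1))"
  proof (rule dvd_det_if_dvd_row[OF F(1)])
    fix j assume j: "j < p - 1"
    have "mod_quot p (p - 1) (Suc j) = int p - mod_quot p 1 (Suc j)"
      "mod_quot p (p - 2) (Suc j) = int p - mod_quot p 2 (Suc j)"
      using assms j by (auto intro!: mod_quot_opposite_row)
    then show "0 dvd fold_rows (A p 1) $$ (0, j)"
      unfolding F(3)[OF j] using n j
      by (simp add: A_index Suc_diff_Suc numeral_2_eq_2)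
  qed (use n in auto)
  then show ?thesis
    unfolding F(2) by simp
qed

text \<open>The numbers \<open>a\<close> and \<open>b - a\<close> have different parity, and
  positive powers keep it.\<close>

lemma odd_power_add_power_diff:
  fixes a b :: int
  assumes "odd b" "m > 0"
  shows "odd (a ^ m + (b - a) ^ m)"
  using assms by auto

lemma det_A_cong_0_mod_4:
  assumes p: "prime p" "odd p" "p \<ge> 5" and "m > 0"
  shows "[det (A p m) = 0] (mod 4)"
proof -
  let ?n = "p - 1"
  define B where "B = fold_rows (A p m)"
  \<comment> \<open>Between two transpositions, \<open>fold_rows\<close> folds columns.\<close>
  define C where "C = transpose_mat (fold_rows (transpose_mat B))"
  note FB = fold_rows[OF A_carrier[of p m], folded B_def]
  have n: "?n \<ge> 4" using p by simp
  have B: "B \<in> carrier_mat ?n ?n"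
    using FB(1) n by simp
  then have tB: "transpose_mat B \<in> carrier_mat ?n ?n" by simp
  note FC = fold_rows[OF tB n]
  have C: "C \<in> carrier_mat ?n ?n"
    using FC(1) by (simp add: C_def)
  have det: "det C = det (A p m)"
    using FC(1,2) FB(2) n B by (simp add: C_def det_transpose)
  have C_0: "C $$ (i, 0) = B $$ (i, 0) + B $$ (i, ?n - 1) - (B $$ (i, 1) + B $$ (i, ?n - 2))"
    if "i < ?n" for i
    using that n FC(1) FC(3)[OF that] B by (simp add: C_def)
  have C_j: "C $$ (i, j) = B $$ (i, j)" if "i < ?n" "0 < j" "j < ?n" for i j
    using that n FC(1) FC(4)[of j i] B by (simp add: C_def)
  \<comment> \<open>The index \<open>?n - 1 - i\<close> carries the number \<open>p - Suc i\<close>,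
    the opposite of \<open>Suc i\<close>.\<close>
  have row_opp: "A p m $$ (?n - 1 - i, j) = (int p - mod_quot p (Suc i) (Suc j)) ^ m"
    if "i < ?n" "j < ?n" for i j
    using that p mod_quot_opposite_row[of p "Suc i" "Suc j"]
    by (simp add: A_index Suc_diff_Suc)
  have col_opp: "A p m $$ (i, ?n - 1 - j) = (int p - mod_quot p (Suc i) (Suc j)) ^ m"
    if "i < ?n" "j < ?n" for i j
    using that p mod_quot_opposite_col[of p "Suc i" "Suc j"]
    by (simp add: A_index Suc_diff_Suc)
  have odd_row: "odd (A p m $$ (i, j) + A p m $$ (?n - 1 - i, j))" if "i < ?n" "j < ?n" for i j
    unfolding row_opp[OF that] unfolding A_index[OF that]
    using p \<open>m > 0\<close> by (intro odd_power_add_power_diff) auto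
  have odd_col: "odd (A p m $$ (i, j) + A p m $$ (i, ?n - 1 - j))" if "i < ?n" "j < ?n" for i j
    unfolding col_opp[OF that] unfolding A_index[OF that]
    using p \<open>m > 0\<close> by (intro odd_power_add_power_diff) auto
  have even_B: "even (B $$ (0, j))" if "j < ?n" for j
    unfolding FB(3)[OF n that] using odd_row[of 0 j] odd_row[of 1 j] that n
    by (simp add: numeral_2_eq_2)
  \<comment> \<open>Negating both row and column number keeps the quotient. Reversing the columns
    thus only swaps the two summands within each pair of opposite rows.\<close>
  have sym_B: "B $$ (0, ?n - 1 - j) = B $$ (0, j)" if j: "j < ?n" for j
  proof -
    have "A p m $$ (?n - 1 - i, ?n - 1 - j) = A p m $$ (i, j)" if "i < ?n" for i
    proof -
      have "mod_quot p (Suc i) (Suc (?n - 1 - j)) = int p - mod_quot p (Suc i) (Suc j)"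
        using that j p mod_quot_opposite_col[of p "Suc i" "Suc j"] by (simp add: Suc_diff_Suc)
      then show ?thesis
        using that j row_opp[of i "?n - 1 - j"] by (simp add: A_index)
    qed
    from this[of 0] this[of 1] show ?thesis
      using j n row_opp[of 0 j] row_opp[of 1 j] row_opp[of 0 "?n - 1 - j"] row_opp[of 1 "?n - 1 - j"]
        col_opp[of 0 j] col_opp[of 1 j]
      by (simp add: FB(3) A_index numeral_2_eq_2)
  qed
  have "2 * 2 dvd det C"
  proof (rule mult_dvd_det_if_dvd_row_col[OF C, of 0 0])
    show "even (C $$ (0, j))" if "j < ?n" for j
      using that n by (cases "j = 0") (auto simp: C_0 C_j even_B)
    show "even (C $$ (i, 0))" if "i < ?n" for i
    proof (cases "i = 0")
      case True
      then show ?thesis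
        using n by (auto simp: C_0 even_B)
    next
      \<comment> \<open>Below row 0, \<open>B\<close> agrees with \<open>A p m\<close>, so the entry
        is a difference of two odd sums over opposite columns.\<close>
      case False
      then show ?thesis
        using that n odd_col[of i 0] odd_col[of i 1] by (simp add: C_0 FB(4) numeral_2_eq_2)
    qed
    \<comment> \<open>The corner lies in both the even row and the even column and must supply 4
      alone: the symmetry gives one factor 2, the evenness of row 0 of \<open>B\<close> the
      other.\<close>
    have C_00: "C $$ (0, 0) = 2 * (B $$ (0, 0) - B $$ (0, 1))"
      using n sym_B[of 0] sym_B[of 1] by (simp add: C_0 numeral_2_eq_2)
    show "2 * 2 dvd C $$ (0, 0)"
      unfolding C_00 using n by (intro mult_dvd_mono dvd_diff even_B) auto
  qed (use n in auto)
  then show ?thesis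
    by (simp add: det cong_0_iff)
qed

section \<open>Nonvanishing for large exponents\<close>

lemma det_A_nonzero_if_dominant:
  assumes "prime p" and dom: "(\<Sum>k = 1..p - 2. int k ^ m) < int (p - 1) ^ m"
  shows "det (A p m) \<noteq> 0"
proof (rule det_nonzero_if_dominant[OF A_carrier])
  fix j assume j: "j < p - 1"
  \<comment> \<open>The row number \<open>Suc ?i\<close> is the opposite of the column number
    \<open>Suc j\<close>, so the quotient is -1, that is \<open>p - 1\<close>.\<close>
  let ?i = "p - 2 - j"
  have i: "?i < p - 1" "Suc ?i = p - Suc j"
    using j by auto
  have quot: "mod_quot p (Suc ?i) (Suc j) = int (p - 1)"
    unfolding i(2) using assms(1) j
    by (simp add: mod_quot_opposite_row mod_quot_self)
  have "bij_betw (mod_quot p (Suc ?i)) ({1..<p} - {Suc j}) ({1..<int p} - {int (p - 1)})"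
    using j quot by (intro bij_betw_DiffI[OF mod_quot_bij_betw[OF assms(1)]]) auto
  also have "{1..<int p} - {int (p - 1)} = int ` {1..p - 2}"
    using j unfolding image_int_atLeastAtMost by auto
  finally have bij: "bij_betw (mod_quot p (Suc ?i)) ({1..<p} - {Suc j}) (int ` {1..p - 2})" .
  have "(\<Sum>k\<in>{0..<p - 1} - {j}. \<bar>A p m $$ (?i, k)\<bar>)
      = (\<Sum>k\<in>{0..<p - 1} - {j}. \<bar>mod_quot p (Suc ?i) (Suc k) ^ m\<bar>)"
    using i by (intro sum.cong) (auto simp: A_index)
  also have "\<dots> = (\<Sum>k\<in>{1..<p} - {Suc j}. \<bar>mod_quot p (Suc ?i) k ^ m\<bar>)"
    using j by (intro sum.reindex_bij_witness[of _ "\<lambda>k. k - 1" Suc]) auto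
  also have "\<dots> = (\<Sum>k\<in>int ` {1..p - 2}. \<bar>k ^ m\<bar>)"
    using sum.reindex_bij_betw[OF bij] .
  also have "\<dots> = (\<Sum>k = 1..p - 2. int k ^ m)"
    by (simp add: sum.reindex)
  also have "\<dots> < \<bar>A p m $$ (?i, j)\<bar>"
    unfolding A_index[OF i(1) j] quot using dom by simp
  finally show "\<exists>i<p - 1. (\<Sum>k\<in>{0..<p - 1} - {j}. \<bar>A p m $$ (i, k)\<bar>) < \<bar>A p m $$ (i, j)\<bar>"
    using i(1) by blast
qed

text \<open>With \<open>q = p - 2\<close>, exponentiating the bound gives
  \<open>q * q ^ m \<le> Suc q ^ m\<close>, and the left side majorizes the sum of \<open>q\<close>
  powers.\<close>

lemma sum_powers_less_if_log_bound:
  fixes p m :: nat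
  assumes "p \<ge> 3" "m > 0"
    and bound: "real m \<ge> ln (real (p - 2)) / ln (real (p - 1) / real (p - 2))"
  shows "(\<Sum>k = 1..p - 2. int k ^ m) < int (p - 1) ^ m"
\<comment> \<open>For \<open>q = 1\<close> that majorization is not strict; here the claim is just
  \<open>1 < 2 ^ m\<close>.\<close>
proof (cases "p = 3")
  case True
  then show ?thesis
    using \<open>m > 0\<close> by (simp add: one_less_power)
next
  case False
  define q where "q = p - 2"
  have q: "q \<ge> 2" "p - 1 = Suc q"
    using assms(1) False by (auto simp: q_def)
  have "ln (real (Suc q) / real q) > 0"
    using q by simp
  then have "ln (real q) \<le> real m * ln (real (Suc q) / real q)"
    using bound unfolding q_def[symmetric] q(2) by (simp add: pos_divide_le_eq)
  also have "\<dots> = ln ((real (Suc q) / real q) ^ m)"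
    using q by (simp add: ln_realpow)
  finally have "real q \<le> (real (Suc q) / real q) ^ m"
    using q by (subst (asm) ln_le_cancel_iff) auto
  then have "real q * real q ^ m \<le> real (Suc q) ^ m"
    using q by (simp add: power_divide pos_le_divide_eq)
  then have *: "q * q ^ m \<le> Suc q ^ m"
    by (metis of_nat_le_iff of_nat_mult of_nat_power)
  \<comment> \<open>Strictness comes from the term \<open>k = 1\<close>, since
    \<open>1 < q ^ m\<close>.\<close>
  have "(\<Sum>k = 1..q. k ^ m) < (\<Sum>k = 1..q. q ^ m)"
    using q one_less_power[of q m] \<open>m > 0\<close>
    by (intro sum_strict_mono_ex1) (auto intro!: power_mono bexI[of _ 1])
  also have "\<dots> \<le> Suc q ^ m"
    using * by simp
  finally have "int (\<Sum>k = 1..q. k ^ m) < int (Suc q ^ m)"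
    by (simp only: of_nat_less_iff)
  then show ?thesis
    unfolding q_def[symmetric] q(2) by (simp only: of_nat_sum of_nat_power)
qed

theorem lemma2p2:
  fixes p m :: nat
  assumes "prime p" and "odd p" and "m > 0"
  shows "(p \<ge> 5 \<longrightarrow> [det (A p m) = 0] (mod 4))
    \<and> (det (A 3 m) = 1 - 4 ^ m \<and> complex_invertible (A 3 m))
    \<and> [det (A p m) = 0] (mod int p)
    \<and> (p \<ge> 5 \<longrightarrow> det (A p 1) = 0 \<and> \<not> complex_invertible (A p 1))
    \<and> ((int (p - 1) ^ m - (\<Sum>k=1..p-2. int k ^ m) > 0 \<longrightarrow> det (A p m) \<noteq> 0)
       \<and> (\<forall>\<^sub>F n in sequentially. det (A p n) \<noteq> 0)
       \<and> (real m \<ge> ln (real (p - 2)) / ln (real (p - 1) / real (p - 2)) \<longrightarrow> det (A p m) \<noteq> 0))"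
proof -
  let ?b = "ln (real (p - 2)) / ln (real (p - 1) / real (p - 2))"
  have "p \<ge> 3"
    using assms(1,2) prime_ge_2_nat[of p] by (cases "p = 2") auto
  then have log: "det (A p n) \<noteq> 0" if "real n \<ge> ?b" "n > 0" for n
    using that assms(1) by (intro det_A_nonzero_if_dominant sum_powers_less_if_log_bound)
  \<comment> \<open>The threshold \<open>?b\<close> depends on \<open>p\<close> only; the maximum
    with 1 ensures \<open>n > 0\<close>.\<close>
  have "\<forall>\<^sub>F n in sequentially. det (A p n) \<noteq> 0"
    using eventually_ge_at_top[of "max 1 (nat \<lceil>?b\<rceil>)"]
    by eventually_elim (intro log; linarith)
  moreover have "(4 :: int) ^ m \<noteq> 1"
    using one_less_power[of "4 :: int" m] assms(3) by linarith
  ultimately show ?thesis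
    using assms log det_A_cong_0_mod_4 det_A_3[of m] det_A_cong_0_mod_prime det_A_1_eq_0
      det_A_nonzero_if_dominant[OF assms(1), of m]
      complex_invertible_iff_det_nonzero[OF A_carrier]
    by auto
qed

end
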